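(* Let $G$ be a graph and let $k$ and $n$ be positive integers with $n\ge k^2$. A covering array $CA(n,G,k)$ exists if and only if there exists a graph homomorphism $G\rightarrow QI(n,k)$.
   Context: $G$ is a finite simple graph. Two vectors $u,v\in\{0,1,\dots,k-1\}^n$ are qualitatively independent if for every ordered pair $(a,b)\in\{0,\dots,k-1\}^2$ there is an index $i$ with $(u_i,v_i)=(a,b)$. A covering array on the graph $G$, denoted $CA(n,G,k)$, is a $|V(G)|\times n$ array with entries from $\{0,1,\dots,k-1\}$ whose rows correspond to the vertices of $G$, such that any two rows corresponding to adjacent vertices of $G$ are qualitatively independent. A $k$-partition of an $n$-set is a set of $k$ disjoint non-empty classes whose union is $\{1,\dots,n\}$. Two $k$-partitions $A=\{A_1,\dots,A_k\}$ and $B=\{B_1,\dots,B_k\}$ of $\{1,\dots,n\}$ are qualitatively independent if $A_i\cap B_j\ne\emptyset$ for all $i,j$. For positive integers $n\ge k^2$, the qualitative independence graph $QI(n,k)$ has as vertices all $k$-partitions of $\{1,\dots,n\}$ in which every class has size at least $k$; vertices are adjacent if and only if the corresponding partitions are qualitatively independent. (For $k\ge 2$ no partition is qualitatively independent of itself, so $QI(n,k)$ is simple; for $k=1$ the definition is read literally, so the unique vertex carries a loop.) A graph homomorphism $G\to H$ is a map $V(G)\to V(H)$ sending adjacent vertices to adjacent vertices. *)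

theory Defs
  imports
    "HOL-Library.FuncSet"
    "HOL-Library.Disjoint_Sets"
    "Graph_Theory.Pair_Digraph"
begin

definition qual_indep_vec :: "nat \<Rightarrow> nat \<Rightarrow> (nat \<Rightarrow> nat) \<Rightarrow> (nat \<Rightarrow> nat) \<Rightarrow> bool" where
  "qual_indep_vec n k u v \<longleftrightarrow>
     (\<forall>a\<in>{0..<k}. \<forall>b\<in>{0..<k}. \<exists>i\<in>{1..n}. (u i, v i) = (a, b))"

text \<open>The array has entry \<open>C x i\<close> in the row of vertex \<open>x\<close> and column \<open>i\<close>. It is taken
  extensional, so that arrays correspond exactly to such functions.\<close>

definition covering_array :: "nat \<Rightarrow> 'a pair_pre_digraph \<Rightarrow> nat \<Rightarrow> ('a \<Rightarrow> nat \<Rightarrow> nat) \<Rightarrow> bool" where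
  "covering_array n G k C \<longleftrightarrow>
     C \<in> pverts G \<rightarrow>\<^sub>E ({1..n} \<rightarrow>\<^sub>E {0..<k}) \<and>
     (\<forall>(x, y)\<in>parcs G. qual_indep_vec n k (C x) (C y))"

definition k_partition :: "nat \<Rightarrow> nat \<Rightarrow> nat set set \<Rightarrow> bool" where
  "k_partition k n P \<longleftrightarrow> partition_on {1..n} P \<and> card P = k"

definition qual_indep_partition :: "nat set set \<Rightarrow> nat set set \<Rightarrow> bool" where
  "qual_indep_partition P Q \<longleftrightarrow> (\<forall>A\<in>P. \<forall>B\<in>Q. A \<inter> B \<noteq> {})"

text \<open>An undirected edge is represented by both of its orientations, and a loop at \<open>P\<close> by the arc
  \<open>(P, P)\<close>. The only loop that occurs for positive \<open>k\<close> is the one at the single vertex for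
  \<open>k = 1\<close>.\<close>

definition QI :: "nat \<Rightarrow> nat \<Rightarrow> nat set set pair_pre_digraph" where
  "QI n k =
     (let V = {P. k_partition k n P \<and> (\<forall>A\<in>P. k \<le> card A)}
      in \<lparr>pverts = V, parcs = {(P, Q). P \<in> V \<and> Q \<in> V \<and> qual_indep_partition P Q}\<rparr>)"

definition graph_hom :: "'a pair_pre_digraph \<Rightarrow> 'b pair_pre_digraph \<Rightarrow> ('a \<Rightarrow> 'b) \<Rightarrow> bool" where
  "graph_hom G H f \<longleftrightarrow>
     f \<in> pverts G \<rightarrow> pverts H \<and> (\<forall>(x, y)\<in>parcs G. (f x, f y) \<in> parcs H)"

end

theory Submission
  imports Defs
begin

text \<open>A word \<open>u\<close> of length \<open>n\<close> in which all of \<open>k\<close> symbols occur and an ordered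
  \<open>k\<close>-partition of \<open>{1..n}\<close> are the same thing: the classes are the fibres of \<open>u\<close>. A pair \<open>(a, b)\<close>
  occurs in the columns of \<open>u\<close> and \<open>v\<close> exactly when the fibre of \<open>u\<close> at \<open>a\<close> meets the fibre of \<open>v\<close>
  at \<open>b\<close>, so qualitative independence of words is qualitative independence of the fibre partitions
  (\<open>qual_indep_fibre_partition_iff\<close>). Hence a homomorphism to \<open>QI n k\<close> turns into a
  covering array as soon as the classes of each partition are numbered
  (\<open>k_partition_is_fibre_partition\<close>), and an array should turn into a homomorphism by taking the fibres of its rows.

  The one thing to check in the latter direction is that the fibres have size at least \<open>k\<close>. This is
  automatic for a row \<open>u\<close> of a vertex with a neighbour: with the neighbour's row \<open>v\<close>, the
  fibre of \<open>u\<close> at \<open>a\<close> contains a position for each of the \<open>k\<close> values of \<open>v\<close>. The row of an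
  isolated vertex is arbitrary, however, and may have to be replaced by a fixed word with large
  fibres; such a word exists precisely because \<open>k\<^sup>2 \<le> n\<close>.\<close>

definition fibre :: "nat \<Rightarrow> (nat \<Rightarrow> nat) \<Rightarrow> nat \<Rightarrow> nat set" where
  "fibre n u a = {i \<in> {1..n}. u i = a}"

definition fibre_partition :: "nat \<Rightarrow> nat \<Rightarrow> (nat \<Rightarrow> nat) \<Rightarrow> nat set set" where
  "fibre_partition n k u = fibre n u ` {0..<k}"

definition large_fibres :: "nat \<Rightarrow> nat \<Rightarrow> (nat \<Rightarrow> nat) \<Rightarrow> bool" where
  "large_fibres n k u \<longleftrightarrow> (\<forall>a\<in>{0..<k}. k \<le> card (fibre n u a))"

lemma finite_fibre: "finite (fibre n u a)"
  by (simp add: fibre_def)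

lemma qual_indep_fibre_partition_iff:
  "qual_indep_partition (fibre_partition n k u) (fibre_partition n k v)
     \<longleftrightarrow> qual_indep_vec n k u v"
proof -
  have "fibre n u a \<inter> fibre n v b \<noteq> {} \<longleftrightarrow> (\<exists>i\<in>{1..n}. (u i, v i) = (a, b))" for a b
    unfolding fibre_def by blast
  then show ?thesis
    by (simp add: qual_indep_partition_def qual_indep_vec_def fibre_partition_def)
qed

lemma qual_indep_vec_imp_large_fibres:
  assumes "qual_indep_vec n k u v"
  shows "large_fibres n k u"
  unfolding large_fibres_def
proof
  fix a assume "a \<in> {0..<k}"
  have "{0..<k} \<subseteq> v ` fibre n u a"
  proof
    fix b assume "b \<in> {0..<k}"
    then obtain i where "i \<in> {1..n}" "u i = a" "v i = b"
      using assms \<open>a \<in> {0..<k}\<close> unfolding qual_indep_vec_def by blast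
    then show "b \<in> v ` fibre n u a"
      by (auto simp: fibre_def)
  qed
  then show "k \<le> card (fibre n u a)"
    using surj_card_le[OF finite_fibre] by fastforce
qed

lemma fibre_partition_in_QI:
  assumes "u \<in> {1..n} \<rightarrow> {0..<k}" and "large_fibres n k u"
  shows "fibre_partition n k u \<in> pverts (QI n k)"
proof -
  have nonempty: "fibre n u a \<noteq> {}" if "a \<in> {0..<k}" for a
  proof -
    have "0 < card (fibre n u a)"
      using assms(2) that by (auto simp: large_fibres_def dest: bspec[OF _ that])
    then show ?thesis by force
  qed
  have "inj_on (fibre n u) {0..<k}"
    using nonempty by (fastforce simp: inj_on_def fibre_def)
  then have "card (fibre_partition n k u) = k"
    by (simp add: fibre_partition_def card_image)
  moreover have "partition_on {1..n} (fibre_partition n k u)"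
  proof (rule partition_onI)
    show "\<Union> (fibre_partition n k u) = {1..n}"
      using assms(1) by (auto simp: fibre_partition_def fibre_def)
    show "{} \<notin> fibre_partition n k u"
      using nonempty by (force simp: fibre_partition_def)
    show "disjnt p q" if "p \<in> fibre_partition n k u" "q \<in> fibre_partition n k u" "p \<noteq> q" for p q
      using that by (auto simp: fibre_partition_def fibre_def disjnt_def)
  qed
  ultimately show ?thesis
    using assms(2)
    by (auto simp: QI_def Let_def k_partition_def large_fibres_def fibre_partition_def)
qed

text \<open>Repeating the block of all \<open>k\<close> symbols as often as possible uses each symbol at least \<open>k\<close>
  times, since at least \<open>k\<close> full blocks of length \<open>k\<close> fit into \<open>n\<close> positions.\<close>

lemma large_fibres_periodic:
  assumes "k\<^sup>2 \<le> n"
  shows "large_fibres n k (\<lambda>i. (i - 1) mod k)"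
  unfolding large_fibres_def
proof
  fix a assume a: "a \<in> {0..<k}"
  \<comment> \<open>The position of the symbol \<open>a\<close> in the block number \<open>j\<close>; positions are counted from 1.\<close>
  let ?pos = "\<lambda>j. j * k + a + 1"
  have "?pos ` {0..<k} \<subseteq> fibre n (\<lambda>i. (i - 1) mod k) a"
  proof
    fix i assume "i \<in> ?pos ` {0..<k}"
    then obtain j where j: "j < k" "i = ?pos j" by auto
    have "?pos j \<le> Suc j * k" using a by simp
    also have "\<dots> \<le> k * k" using j(1) by (intro mult_right_mono) auto
    finally show "i \<in> fibre n (\<lambda>i. (i - 1) mod k) a"
      using assms a j(2) by (simp add: fibre_def power2_eq_square)
  qed
  moreover have "inj_on ?pos {0..<k}"
    using a by (auto simp: inj_on_def)
  ultimately show "k \<le> card (fibre n (\<lambda>i. (i - 1) mod k) a)"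
    using card_inj_on_le[OF _ _ finite_fibre] by fastforce
qed

text \<open>Numbering the classes of a \<open>k\<close>-partition by the symbols gives the word that records, at each
  position, the number of the class containing it. Its fibres are the given classes because each position lies in exactly one.\<close>

lemma k_partition_is_fibre_partition:
  assumes "k_partition k n P"
  obtains u where "u \<in> {1..n} \<rightarrow>\<^sub>E {0..<k}" and "fibre_partition n k u = P"
proof -
  have part: "partition_on {1..n} P" and card: "card P = k"
    using assms by (auto simp: k_partition_def)
  have "finite P"
    using part by (rule finite_elements[rotated]) simp
  then obtain g where g: "bij_betw g {0..<k} P"
    using ex_bij_betw_nat_finite card by blast
  have unique_class: "\<exists>!a. a \<in> {0..<k} \<and> i \<in> g a" if i: "i \<in> {1..n}" for i
  proof -
    have "\<Union> P = {1..n}" using part by (simp add: partition_on_def)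
    then obtain A where A: "A \<in> P" "i \<in> A" using i by blast
    then obtain a where a: "a \<in> {0..<k}" "g a = A"
      using g unfolding bij_betw_def by blast
    have "b = a" if b: "b \<in> {0..<k}" "i \<in> g b" for b
    proof -
      have "g b \<in> P" using g b(1) by (rule bij_betwE[THEN bspec])
      then have "g b = A"
        using A b(2) part by (auto simp: partition_on_def disjoint_def)
      then show ?thesis
        using a b(1) g by (auto simp: bij_betw_def inj_on_def)
    qed
    then show ?thesis using a A by blast
  qed
  define u where "u = (\<lambda>i\<in>{1..n}. THE a. a \<in> {0..<k} \<and> i \<in> g a)"
  have u: "u i \<in> {0..<k} \<and> i \<in> g (u i)" if "i \<in> {1..n}" for i
    using theI'[OF unique_class[OF that]] that by (simp add: u_def)
  have "fibre n u a = g a" if a: "a \<in> {0..<k}" for a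
  proof -
    have "g a \<in> P" using g a by (rule bij_betwE[THEN bspec])
    then have "g a \<subseteq> {1..n}" using part by (auto simp: partition_on_def)
    then show ?thesis
      unfolding fibre_def using u unique_class a by blast
  qed
  then have "fibre_partition n k u = g ` {0..<k}"
    by (simp add: fibre_partition_def)
  also have "\<dots> = P" using g by (simp add: bij_betw_def)
  finally have "fibre_partition n k u = P" .
  moreover have "u \<in> {1..n} \<rightarrow>\<^sub>E {0..<k}"
    using u by (auto simp: u_def)
  ultimately show thesis by (rule that[rotated])
qed

lemma covering_array_imp_graph_hom:
  assumes "pair_graph G" and "0 < k" and "k\<^sup>2 \<le> n" and C: "covering_array n G k C"
  shows "\<exists>f. graph_hom G (QI n k) f"
proof -
  interpret pair_graph G by fact
  \<comment> \<open>Only rows of isolated vertices can be affected by the replacement.\<close>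
  define row where "row x = (if large_fibres n k (C x) then C x else (\<lambda>i. (i - 1) mod k))" for x
  define f where "f x = fibre_partition n k (row x)" for x
  have verts: "f x \<in> pverts (QI n k)" if "x \<in> pverts G" for x
    unfolding f_def
  proof (rule fibre_partition_in_QI)
    have "C x \<in> {1..n} \<rightarrow> {0..<k}"
      using C that by (auto simp: covering_array_def PiE_def)
    then show "row x \<in> {1..n} \<rightarrow> {0..<k}"
      using \<open>0 < k\<close> by (auto simp: row_def)
    show "large_fibres n k (row x)"
      using large_fibres_periodic[OF \<open>k\<^sup>2 \<le> n\<close>] by (simp add: row_def)
  qed
  have "(f x, f y) \<in> parcs (QI n k)" if xy: "(x, y) \<in> parcs G" for x y
  proof -
    have "(y, x) \<in> parcs G"
      using xy arcs_symmetric by blast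
    then have indep: "qual_indep_vec n k (C x) (C y)" "qual_indep_vec n k (C y) (C x)"
      using C xy by (auto simp: covering_array_def)
    then have "row x = C x" "row y = C y"
      by (simp_all add: row_def qual_indep_vec_imp_large_fibres)
    then have "qual_indep_partition (f x) (f y)"
      using indep by (simp add: f_def qual_indep_fibre_partition_iff)
    moreover have "x \<in> pverts G" "y \<in> pverts G"
      using xy in_arcsD1 in_arcsD2 by blast+
    ultimately show ?thesis
      using verts[of x] verts[of y] by (simp add: QI_def Let_def)
  qed
  then have "graph_hom G (QI n k) f"
    using verts by (auto simp: graph_hom_def)
  then show ?thesis by blast
qed

lemma graph_hom_imp_covering_array:
  assumes "pair_wf_digraph G" and f: "graph_hom G (QI n k) f"
  shows "\<exists>C. covering_array n G k C"
proof -
  interpret pair_wf_digraph G by fact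
  have "\<exists>u. u \<in> {1..n} \<rightarrow>\<^sub>E {0..<k} \<and> fibre_partition n k u = f x" if "x \<in> pverts G" for x
  proof -
    have "k_partition k n (f x)"
      using f that by (auto simp: graph_hom_def QI_def Let_def)
    then show ?thesis
      by (rule k_partition_is_fibre_partition) blast
  qed
  then obtain r where r: "r x \<in> {1..n} \<rightarrow>\<^sub>E {0..<k}" "fibre_partition n k (r x) = f x"
    if "x \<in> pverts G" for x
    by metis
  have "qual_indep_vec n k (r x) (r y)" if xy: "(x, y) \<in> parcs G" for x y
  proof -
    have "qual_indep_partition (f x) (f y)"
      using f xy by (auto simp: graph_hom_def QI_def Let_def)
    then show ?thesis
      using r(2) xy in_arcsD1 in_arcsD2 by (metis qual_indep_fibre_partition_iff)
  qed
  then have "covering_array n G k (restrict r (pverts G))"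
    using r(1) in_arcsD1 in_arcsD2 by (fastforce simp: covering_array_def)
  then show ?thesis by blast
qed

theorem theorem5p2p7:
  fixes G :: "'a pair_pre_digraph" and k n :: nat
  assumes "pair_graph G"
    and "0 < k" and "0 < n"
    and "k\<^sup>2 \<le> n"
  shows "(\<exists>C. covering_array n G k C) \<longleftrightarrow> (\<exists>f. graph_hom G (QI n k) f)"
proof -
  interpret pair_graph G by fact
  show ?thesis
    using covering_array_imp_graph_hom[OF assms(1,2,4)]
      graph_hom_imp_covering_array[OF pair_wf_digraph_axioms] by blast
qed

end
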